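(* Let $a$ and $b$ be nonnegative real parameters with $a\neq b$, let $x\in[a,b]$, let $t\in\mathbb{C}$, let $m$ be a positive integer and $k$ a nonnegative integer. Let $l$ be a nonnegative integer. Then $$\frac{\partial^{l}f_{\mathbb{Y},k}(x,t;a,b,m)}{\partial x^{l}}=\sum_{j=0}^{l}\binom{l}{j}(-1)^{l-j}\frac{t^{l}}{(b-a)^{j}}f_{\mathbb{Y},k-j}(x,t;a,b,m-j).$$
   Context: Here $[a,b]=\{x\in\mathbb{R}: a\le x\le b\}$ (so $a<b$). For an integer $m$ and a nonnegative integer $k$, $$f_{\mathbb{Y},k}(x,t;a,b,m)=\frac{t^{k}(x-a)^{k}e^{(b-x)t}}{(b-a)^{m}\,k!},$$ and $f_{\mathbb{Y},k}=0$ when $k<0$. The right-hand side of the formula makes sense for all real $x$, and the partial derivative in $x$ is the derivative of this function of $x$. Convention: $0^0=1$. *)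

theory Defs
  imports "HOL-Analysis.Analysis"
begin

text \<open>
  Both \<open>k\<close> and \<open>m\<close> are integers: shifted indices \<open>k - j\<close> and \<open>m - j\<close> may become negative.
  The function is defined for all real \<open>x\<close>; natural-number powers satisfy \<open>0 ^ 0 = 1\<close>.
\<close>

definition fY :: "int \<Rightarrow> real \<Rightarrow> complex \<Rightarrow> real \<Rightarrow> real \<Rightarrow> int \<Rightarrow> complex" where
  "fY k x t a b m =
     (if k < 0 then 0
      else t ^ nat k * complex_of_real (x - a) ^ nat k * exp (complex_of_real (b - x) * t)
             / (complex_of_real (b - a) powi m * fact (nat k)))"

text \<open>
  Iterated derivative of a complex-valued function of a real variable. As
  \<^const>\<open>vector_derivative\<close> has an unspecified value where the derivative does not exist,
  equations about it should come with the existence of the derivatives involved.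
\<close>

definition higher_vderiv :: "nat \<Rightarrow> (real \<Rightarrow> complex) \<Rightarrow> real \<Rightarrow> complex" where
  "higher_vderiv l g = ((\<lambda>h x. vector_derivative h (at x)) ^^ l) g"

end

theory Submission
  imports Defs
begin

text \<open>
  Write \<open>c = b - a\<close> and normalise the shifted functions to \<open>h\<^sub>j = f\<^sub>k\<^sub>-\<^sub>j(\<dots>, m - j) / c\<^sup>j\<close>.
  The product rule, applied to the factors \<open>(x - a)\<^sup>k\<close> and \<open>exp ((b - x) t)\<close>, gives
  \<open>h\<^sub>j' = t (h\<^sub>j\<^sub>+\<^sub>1 - h\<^sub>j)\<close> (lemma \<open>fY_has_vector_derivative\<close>): along this sequence
  differentiation acts as \<open>t (S - 1)\<close>, where \<open>S\<close> is the index shift. The formula is the binomial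
  expansion of \<open>t\<^sup>l (S - 1)\<^sup>l\<close>, and lemma \<open>binomial_sum_difference\<close> is the step from
  \<open>(S - 1)\<^sup>l\<close> to \<open>(S - 1)\<^sup>l\<^sup>+\<^sup>1\<close>.

  The recursion holds at every real point and for every integer index, because the convention
  \<open>f\<^sub>k = 0\<close> for \<open>k < 0\<close> absorbs the boundary case \<open>k = 0\<close>. The iterated derivatives are
  therefore known as functions on the whole line, which also yields their differentiability.
\<close>

text \<open>
  This is Pascal's rule for the signed coefficients of \<open>(S - 1)\<^sup>l\<close>, collected by the index of \<open>h\<close>.
\<close>

lemma binomial_sum_difference:
  fixes h :: "nat \<Rightarrow> 'a::comm_ring_1"
  shows "(\<Sum>j\<le>l. of_nat (l choose j) * (-1) ^ (l - j) * (h (Suc j) - h j)) =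
         (\<Sum>j\<le>Suc l. of_nat (Suc l choose j) * (-1) ^ (Suc l - j) * h j)"
proof -
  define A where "A = (\<lambda>l j. of_nat (l choose j) * (-1) ^ (l - j) :: 'a)"
  have A_0: "A (Suc l) 0 = - A l 0"
    by (simp add: A_def)
  \<comment> \<open>At \<open>j = l\<close> the truncated exponent \<open>l - Suc l\<close> is harmless, as \<open>l choose Suc l\<close> vanishes.\<close>
  have A_Suc: "A (Suc l) (Suc j) = A l j - A l (Suc j)" if "j \<le> l" for j
  proof (cases "j = l")
    case True
    then show ?thesis by (simp add: A_def binomial_eq_0)
  next
    case False
    then have "l - j = Suc (l - Suc j)" using that by simp
    then show ?thesis by (simp add: A_def algebra_simps)
  qed
  have "(\<Sum>j\<le>l. A l j * h j) = (\<Sum>j\<le>Suc l. A l j * h j)"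
    by (simp add: A_def binomial_eq_0)
  also have "\<dots> = A l 0 * h 0 + (\<Sum>j\<le>l. A l (Suc j) * h (Suc j))"
    by (rule sum.atMost_Suc_shift)
  finally have shift: "(\<Sum>j\<le>l. A l j * h j) = \<dots>" .
  have "(\<Sum>j\<le>Suc l. A (Suc l) j * h j) =
        A (Suc l) 0 * h 0 + (\<Sum>j\<le>l. A (Suc l) (Suc j) * h (Suc j))"
    by (rule sum.atMost_Suc_shift)
  also have "\<dots> = - A l 0 * h 0 + (\<Sum>j\<le>l. (A l j - A l (Suc j)) * h (Suc j))"
    by (simp add: A_0 A_Suc)
  also have "\<dots> = (\<Sum>j\<le>l. A l j * (h (Suc j) - h j))"
    using shift by (simp add: algebra_simps sum_subtractf)
  finally show ?thesis by (simp add: A_def)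
qed

lemma higher_vderiv_Suc:
  "higher_vderiv (Suc l) g = (\<lambda>x. vector_derivative (higher_vderiv l g) (at x))"
  by (simp add: higher_vderiv_def)

lemma higher_vderiv_eqI:
  assumes "\<And>l y. (G l has_vector_derivative G (Suc l) y) (at y)"
  shows "higher_vderiv l (G 0) = G l"
proof (induction l)
  case 0
  show ?case by (simp add: higher_vderiv_def)
next
  case (Suc l)
  then show ?case
    by (simp add: higher_vderiv_Suc vector_derivative_at[OF assms])
qed

lemma higher_vderiv_difference_recursion:
  fixes h :: "nat \<Rightarrow> real \<Rightarrow> complex"
  assumes h: "\<And>j y. (h j has_vector_derivative t * (h (Suc j) y - h j y)) (at y)"
  shows "higher_vderiv l (h 0) =
           (\<lambda>y. t ^ l * (\<Sum>j\<le>l. of_nat (l choose j) * (-1) ^ (l - j) * h j y))" (is ?formula)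
    and "higher_vderiv l (h 0) differentiable (at y)"
proof -
  define G where
    "G = (\<lambda>l y. t ^ l * (\<Sum>j\<le>l. of_nat (l choose j) * (-1) ^ (l - j) * h j y))"
  have deriv_G: "(G l has_vector_derivative G (Suc l) y) (at y)" for l y
  proof -
    have "(G l has_vector_derivative
            t ^ l * (\<Sum>j\<le>l. of_nat (l choose j) * (-1) ^ (l - j) * (t * (h (Suc j) y - h j y))))
          (at y)"
      unfolding G_def
      by (intro has_vector_derivative_mult_right has_vector_derivative_sum h)
    moreover have
      "t ^ l * (\<Sum>j\<le>l. of_nat (l choose j) * (-1) ^ (l - j) * (t * (h (Suc j) y - h j y))) =
       t ^ Suc l * (\<Sum>j\<le>l. of_nat (l choose j) * (-1) ^ (l - j) * (h (Suc j) y - h j y))"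
      by (simp add: sum_distrib_left mult_ac)
    ultimately show ?thesis
      unfolding G_def using binomial_sum_difference[of l "\<lambda>j. h j y"] by simp
  qed
  have "G 0 = h 0" by (simp add: G_def)
  then have eq: "higher_vderiv l (h 0) = G l"
    using higher_vderiv_eqI[of G l] deriv_G by simp
  then show ?formula by (simp add: G_def)
  show "higher_vderiv l (h 0) differentiable (at y)"
    unfolding eq using deriv_G by (rule differentiableI_vector)
qed

text \<open>
  The derivative of \<open>(x - a)\<^sup>k / k!\<close> lowers \<open>k\<close> and leaves \<open>m\<close> alone; lowering \<open>m\<close> as well costs
  the factor \<open>1 / (b - a)\<close>.
\<close>

lemma fY_has_vector_derivative:
  assumes "a \<noteq> b"
  shows "((\<lambda>x. fY k x t a b m) has_vector_derivative
           t * (fY (k - 1) y t a b (m - 1) / complex_of_real (b - a) - fY k y t a b m)) (at y)"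
proof (cases "k < 0")
  case True
  then show ?thesis by (simp add: fY_def)
next
  case False
  then obtain n where k: "k = int n" by (metis int_nat_eq not_less)
  define c where "c = complex_of_real (b - a)"
  define C where "C = c powi m"
  have c: "c \<noteq> 0" using assms by (simp add: c_def)
  then have C: "C \<noteq> 0" by (simp add: C_def)
  have lower_m: "c powi (m - 1) * c = C"
    using c by (simp add: C_def power_int_diff)
  define P where "P = complex_of_real (y - a)"
  define E where "E = exp (complex_of_real (b - y) * t)"
  \<comment> \<open>\<open>f\<close> extends the function to complex \<open>z\<close>, where the rules for field derivatives apply.\<close>
  define f where "f = (\<lambda>z. t ^ n * (z - of_real a) ^ n * exp ((of_real b - z) * t) / (C * fact n))"
  have fY_f: "(\<lambda>x. fY k x t a b m) = (\<lambda>x. f (of_real x))"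
    by (simp add: fun_eq_iff fY_def f_def k C_def c_def)
  have "(f has_field_derivative
          t ^ n * (of_nat n * P ^ (n - 1) * E - P ^ n * t * E) / (C * fact n)) (at (of_real y))"
    unfolding f_def P_def E_def using C
    by (auto intro!: derivative_eq_intros simp: field_simps)
  then have deriv: "((\<lambda>x. fY k x t a b m) has_vector_derivative
          t ^ n * (of_nat n * P ^ (n - 1) * E - P ^ n * t * E) / (C * fact n)) (at y)"
    unfolding fY_f by (rule has_vector_derivative_real_field)
  have fY_y: "fY k y t a b m = t ^ n * P ^ n * E / (C * fact n)"
    by (simp add: fY_def k P_def E_def C_def c_def)
  have "t ^ n * (of_nat n * P ^ (n - 1) * E - P ^ n * t * E) / (C * fact n) =
        t * (fY (k - 1) y t a b (m - 1) / c - fY k y t a b m)"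
  proof (cases n)
    case 0
    then show ?thesis using C by (simp add: fY_y) (simp add: fY_def k)
  next
    case (Suc p)
    then have "fY (k - 1) y t a b (m - 1) = t ^ p * P ^ p * E / (c powi (m - 1) * fact p)"
      by (simp add: fY_def k P_def E_def c_def)
    then have fY_lower: "fY (k - 1) y t a b (m - 1) / c = t ^ p * P ^ p * E / (C * fact p)"
      using lower_m by (simp add: mult_ac flip: lower_m)
    define N :: complex where "N = of_nat (Suc p)"
    then have "N \<noteq> 0" "fact n = N * (fact p :: complex)" "of_nat n = N"
      using Suc by (simp_all del: of_nat_Suc)
    then show ?thesis
      unfolding fY_lower fY_y using C by (simp add: Suc field_simps del: fact_Suc of_nat_Suc)
  qed
  with deriv show ?thesis by (simp add: c_def)
qed

theorem theorem4:
  fixes a b x :: real and t :: complex and m k :: int and l :: nat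
  assumes "a \<ge> 0" and "b \<ge> 0" and "a \<noteq> b" and "x \<in> {a..b}" and "m > 0" and "k \<ge> 0"
  shows "(\<forall>i<l. \<forall>y. higher_vderiv i (\<lambda>x. fY k x t a b m) differentiable (at y)) \<and>
         higher_vderiv l (\<lambda>x. fY k x t a b m) x =
           (\<Sum>j=0..l. of_nat (l choose j) * (-1) ^ (l - j) * (t ^ l / complex_of_real (b - a) ^ j)
                        * fY (k - int j) x t a b (m - int j))"
proof -
  define c where "c = complex_of_real (b - a)"
  define h where "h = (\<lambda>j y. fY (k - int j) y t a b (m - int j) / c ^ j)"
  have h: "(h j has_vector_derivative t * (h (Suc j) y - h j y)) (at y)" for j y
  proof -
    have "(h j has_vector_derivative
            t * (fY (k - int j - 1) y t a b (m - int j - 1) / c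
                   - fY (k - int j) y t a b (m - int j)) / c ^ j) (at y)"
      unfolding h_def c_def
      by (intro has_vector_derivative_divide fY_has_vector_derivative assms)
    moreover have "k - int j - 1 = k - int (Suc j)" "m - int j - 1 = m - int (Suc j)"
      by simp_all
    ultimately show ?thesis
      by (simp add: h_def diff_divide_distrib right_diff_distrib mult.commute)
  qed
  have h_0: "h 0 = (\<lambda>x. fY k x t a b m)" by (simp add: h_def)
  have "higher_vderiv l (h 0) x =
          t ^ l * (\<Sum>j\<le>l. of_nat (l choose j) * (-1) ^ (l - j) * h j x)"
    by (simp add: higher_vderiv_difference_recursion(1)[where h = h and t = t] h)
  also have "\<dots> = (\<Sum>j=0..l. of_nat (l choose j) * (-1) ^ (l - j) * (t ^ l / c ^ j)
                        * fY (k - int j) x t a b (m - int j))"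
    by (simp add: sum_distrib_left h_def atMost_atLeast0 mult_ac)
  finally show ?thesis
    using higher_vderiv_difference_recursion(2)[where h = h and t = t, OF h]
    by (simp add: h_0 c_def)
qed

end
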